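(* For any quantale $\mathbf{Q}$, the category of left $\mathbf{Q}$-modules and the category of right $\mathbf{Q}$-modules have the strong amalgamation property.
   Context: A quantale $\mathbf{Q}=\langle Q,\vee,\cdot,\bot,e\rangle$ is a complete lattice with a monoid structure $\langle Q,\cdot,e\rangle$ whose product distributes over arbitrary joins in both arguments. A left $\mathbf{Q}$-module is a sup-lattice (poset with arbitrary joins) $\mathbf{M}$ with $\star:Q\times M\to M$ preserving arbitrary joins in each argument, with $(q_1q_2)\star m=q_1\star(q_2\star m)$ and $e\star m=m$; right modules are analogous. Morphisms preserve arbitrary joins and scalar multiplication. An amalgam in a category is a 5-tuple $(A,f,B,g,C)$ with objects $A,B,C$ and injective morphisms $f:A\to B$, $g:A\to C$. The category has the strong amalgamation property if for every amalgam $(A,f,B,g,C)$ with $A\ne\varnothing$ there exist an object $D$ and injective morphisms $f':B\to D$, $g':C\to D$ such that $f'\circ f=g'\circ g$ and $f'[B]\cap g'[C]=(f'\circ f)[A]=(g'\circ g)[A]$. *)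

theory Defs
  imports "HOL-Algebra.Group"
begin

section \<open>Sup-lattices\<close>

text \<open>Orders are the carrier-based ones of HOL-Algebra. In the locale \<open>partial_order\<close> the
  field \<open>eq\<close> is forced to be equality.\<close>

locale sup_lattice = partial_order L for L (structure) +
  assumes join_exists: "A \<subseteq> carrier L \<Longrightarrow> \<exists>s. least L s (Upper L A)"

text \<open>The library's \<open>sup_pres\<close> (preservation of arbitrary joins, the empty one included)
  carries \<open>complete_lattice\<close> assumptions on source and target. They hold automatically
  for sup-lattices:\<close>

lemma sup_lattice_iff_complete_lattice: "sup_lattice L \<longleftrightarrow> complete_lattice L"
proof
  assume "sup_lattice L"
  then interpret sup_lattice L .
  show "complete_lattice L"
  proof (unfold_locales)
    fix A assume A: "A \<subseteq> carrier L"
    show "\<exists>s. least L s (Upper L A)"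
      using A by (rule join_exists)
    have "Lower L A \<subseteq> carrier L" by simp
    then obtain s where "least L s (Upper L (Lower L A))"
      using join_exists by blast
    then have "greatest L s (Lower L A)"
      using A by (auto simp: least_def greatest_def Upper_def Lower_def)
    then show "\<exists>i. greatest L i (Lower L A)" ..
  qed
next
  assume "complete_lattice L"
  then interpret complete_lattice L .
  show "sup_lattice L"
    by unfold_locales (rule sup_exists)
qed

section \<open>Quantales\<close>

record 'q quantale = "'q gorder" +
  qmult :: "'q \<Rightarrow> 'q \<Rightarrow> 'q"  (infixl \<open>\<cdot>\<index>\<close> 70)
  qunit :: 'q

locale quantale = complete_lattice Q for Q (structure) +
  assumes qmult_monoid:
      "monoid \<lparr>carrier = carrier Q, monoid.mult = (\<cdot>), one = qunit Q\<rparr>"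
    and qmult_sup_right: "a \<in> carrier Q \<Longrightarrow> sup_pres Q Q (\<lambda>b. a \<cdot> b)"
    and qmult_sup_left: "b \<in> carrier Q \<Longrightarrow> sup_pres Q Q (\<lambda>a. a \<cdot> b)"

section \<open>Modules over a quantale\<close>

record ('q, 'm) left_qmodule = "'m gorder" +
  lact :: "'q \<Rightarrow> 'm \<Rightarrow> 'm"  (infixr \<open>\<star>\<index>\<close> 75)

record ('q, 'm) right_qmodule = "'m gorder" +
  ract :: "'m \<Rightarrow> 'q \<Rightarrow> 'm"  (infixl \<open>\<triangleleft>\<index>\<close> 75)

locale left_qmodule = Q?: quantale Q + M?: sup_lattice M
  for Q :: "('q, 'y) quantale_scheme" (structure)
    and M :: "('q, 'm, 'z) left_qmodule_scheme" (structure) +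
  assumes lact_closed:
      "\<lbrakk>q \<in> carrier Q; m \<in> carrier M\<rbrakk> \<Longrightarrow> q \<star>\<^bsub>M\<^esub> m \<in> carrier M"
    and lact_sup_scalar: "m \<in> carrier M \<Longrightarrow> sup_pres Q M (\<lambda>q. q \<star>\<^bsub>M\<^esub> m)"
    and lact_sup_vector: "q \<in> carrier Q \<Longrightarrow> sup_pres M M (\<lambda>m. q \<star>\<^bsub>M\<^esub> m)"
    and lact_assoc:
      "\<lbrakk>p \<in> carrier Q; q \<in> carrier Q; m \<in> carrier M\<rbrakk> \<Longrightarrow>
        (p \<cdot>\<^bsub>Q\<^esub> q) \<star>\<^bsub>M\<^esub> m = p \<star>\<^bsub>M\<^esub> (q \<star>\<^bsub>M\<^esub> m)"
    and lact_unit: "m \<in> carrier M \<Longrightarrow> qunit Q \<star>\<^bsub>M\<^esub> m = m"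

locale right_qmodule = Q?: quantale Q + M?: sup_lattice M
  for Q :: "('q, 'y) quantale_scheme" (structure)
    and M :: "('q, 'm, 'z) right_qmodule_scheme" (structure) +
  assumes ract_closed:
      "\<lbrakk>m \<in> carrier M; q \<in> carrier Q\<rbrakk> \<Longrightarrow> m \<triangleleft>\<^bsub>M\<^esub> q \<in> carrier M"
    and ract_sup_scalar: "m \<in> carrier M \<Longrightarrow> sup_pres Q M (\<lambda>q. m \<triangleleft>\<^bsub>M\<^esub> q)"
    and ract_sup_vector: "q \<in> carrier Q \<Longrightarrow> sup_pres M M (\<lambda>m. m \<triangleleft>\<^bsub>M\<^esub> q)"
    and ract_assoc:
      "\<lbrakk>m \<in> carrier M; p \<in> carrier Q; q \<in> carrier Q\<rbrakk> \<Longrightarrow>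
        m \<triangleleft>\<^bsub>M\<^esub> (p \<cdot>\<^bsub>Q\<^esub> q) = (m \<triangleleft>\<^bsub>M\<^esub> p) \<triangleleft>\<^bsub>M\<^esub> q"
    and ract_unit: "m \<in> carrier M \<Longrightarrow> m \<triangleleft>\<^bsub>M\<^esub> qunit Q = m"

definition left_qmodule_hom ::
  "('q, 'y) quantale_scheme \<Rightarrow> ('q, 'm, 'u) left_qmodule_scheme \<Rightarrow>
    ('q, 'n, 'v) left_qmodule_scheme \<Rightarrow> ('m \<Rightarrow> 'n) set" where
  "left_qmodule_hom Q M N =
    {h \<in> carrier M \<rightarrow> carrier N. sup_pres M N h \<and>
      (\<forall>q\<in>carrier Q. \<forall>m\<in>carrier M. h (q \<star>\<^bsub>M\<^esub> m) = q \<star>\<^bsub>N\<^esub> h m)}"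

definition right_qmodule_hom ::
  "('q, 'y) quantale_scheme \<Rightarrow> ('q, 'm, 'u) right_qmodule_scheme \<Rightarrow>
    ('q, 'n, 'v) right_qmodule_scheme \<Rightarrow> ('m \<Rightarrow> 'n) set" where
  "right_qmodule_hom Q M N =
    {h \<in> carrier M \<rightarrow> carrier N. sup_pres M N h \<and>
      (\<forall>q\<in>carrier Q. \<forall>m\<in>carrier M. h (m \<triangleleft>\<^bsub>M\<^esub> q) = h m \<triangleleft>\<^bsub>N\<^esub> q)}"

section \<open>Amalgams and strong amalgamation\<close>

text \<open>The three modules of an amalgam may live on three different types. Maps matter only
  on carriers, so injectivity and commutativity are stated there.\<close>

definition left_amalgam ::
  "('q, 'y) quantale_scheme \<Rightarrow> ('q, 'a) left_qmodule \<Rightarrow> ('a \<Rightarrow> 'b) \<Rightarrow>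
    ('q, 'b) left_qmodule \<Rightarrow> ('a \<Rightarrow> 'c) \<Rightarrow> ('q, 'c) left_qmodule \<Rightarrow> bool" where
  "left_amalgam Q A f B g C \<longleftrightarrow>
    left_qmodule Q A \<and> left_qmodule Q B \<and> left_qmodule Q C \<and>
    f \<in> left_qmodule_hom Q A B \<and> inj_on f (carrier A) \<and>
    g \<in> left_qmodule_hom Q A C \<and> inj_on g (carrier A)"

definition right_amalgam ::
  "('q, 'y) quantale_scheme \<Rightarrow> ('q, 'a) right_qmodule \<Rightarrow> ('a \<Rightarrow> 'b) \<Rightarrow>
    ('q, 'b) right_qmodule \<Rightarrow> ('a \<Rightarrow> 'c) \<Rightarrow> ('q, 'c) right_qmodule \<Rightarrow> bool" where
  "right_amalgam Q A f B g C \<longleftrightarrow>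
    right_qmodule Q A \<and> right_qmodule Q B \<and> right_qmodule Q C \<and>
    f \<in> right_qmodule_hom Q A B \<and> inj_on f (carrier A) \<and>
    g \<in> right_qmodule_hom Q A C \<and> inj_on g (carrier A)"

definition left_strong_completion ::
  "('q, 'y) quantale_scheme \<Rightarrow> ('q, 'a) left_qmodule \<Rightarrow> ('a \<Rightarrow> 'b) \<Rightarrow>
    ('q, 'b) left_qmodule \<Rightarrow> ('a \<Rightarrow> 'c) \<Rightarrow> ('q, 'c) left_qmodule \<Rightarrow>
    ('q, 'd) left_qmodule \<Rightarrow> ('b \<Rightarrow> 'd) \<Rightarrow> ('c \<Rightarrow> 'd) \<Rightarrow> bool" where
  "left_strong_completion Q A f B g C D f' g' \<longleftrightarrow>
    left_qmodule Q D \<and>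
    f' \<in> left_qmodule_hom Q B D \<and> inj_on f' (carrier B) \<and>
    g' \<in> left_qmodule_hom Q C D \<and> inj_on g' (carrier C) \<and>
    (\<forall>a\<in>carrier A. (f' \<circ> f) a = (g' \<circ> g) a) \<and>
    f' ` carrier B \<inter> g' ` carrier C = (f' \<circ> f) ` carrier A \<and>
    (f' \<circ> f) ` carrier A = (g' \<circ> g) ` carrier A"

definition right_strong_completion ::
  "('q, 'y) quantale_scheme \<Rightarrow> ('q, 'a) right_qmodule \<Rightarrow> ('a \<Rightarrow> 'b) \<Rightarrow>
    ('q, 'b) right_qmodule \<Rightarrow> ('a \<Rightarrow> 'c) \<Rightarrow> ('q, 'c) right_qmodule \<Rightarrow>
    ('q, 'd) right_qmodule \<Rightarrow> ('b \<Rightarrow> 'd) \<Rightarrow> ('c \<Rightarrow> 'd) \<Rightarrow> bool" where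
  "right_strong_completion Q A f B g C D f' g' \<longleftrightarrow>
    right_qmodule Q D \<and>
    f' \<in> right_qmodule_hom Q B D \<and> inj_on f' (carrier B) \<and>
    g' \<in> right_qmodule_hom Q C D \<and> inj_on g' (carrier C) \<and>
    (\<forall>a\<in>carrier A. (f' \<circ> f) a = (g' \<circ> g) a) \<and>
    f' ` carrier B \<inter> g' ` carrier C = (f' \<circ> f) ` carrier A \<and>
    (f' \<circ> f) ` carrier A = (g' \<circ> g) ` carrier A"

text \<open>HOL cannot quantify existentially over types, so strong amalgamation fixes the type
  that carries the amalgamating object \<open>D\<close>. For \<open>B\<close> and \<open>C\<close> on types \<open>'b\<close> and \<open>'c\<close>, the
  product type \<open>'b \<times> 'c\<close> is used, because the coproduct of \<open>B\<close> and \<open>C\<close> has \<open>B \<times> C\<close> as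
  underlying set and quotients of a sup-lattice are represented by closed elements. The four
  type arguments are the types carrying \<open>A\<close>, \<open>B\<close>, \<open>C\<close> and \<open>D\<close>.\<close>

definition left_strong_amalgamation_property ::
  "'q quantale \<Rightarrow> 'a itself \<Rightarrow> 'b itself \<Rightarrow> 'c itself \<Rightarrow> 'd itself \<Rightarrow> bool" where
  "left_strong_amalgamation_property Q (_ :: 'a itself) (_ :: 'b itself) (_ :: 'c itself)
      (_ :: 'd itself) \<longleftrightarrow>
    (\<forall>(A :: ('q, 'a) left_qmodule) f (B :: ('q, 'b) left_qmodule) g
        (C :: ('q, 'c) left_qmodule).
      left_amalgam Q A f B g C \<and> carrier A \<noteq> {} \<longrightarrow>
      (\<exists>(D :: ('q, 'd) left_qmodule) f' g'. left_strong_completion Q A f B g C D f' g'))"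

definition right_strong_amalgamation_property ::
  "'q quantale \<Rightarrow> 'a itself \<Rightarrow> 'b itself \<Rightarrow> 'c itself \<Rightarrow> 'd itself \<Rightarrow> bool" where
  "right_strong_amalgamation_property Q (_ :: 'a itself) (_ :: 'b itself) (_ :: 'c itself)
      (_ :: 'd itself) \<longleftrightarrow>
    (\<forall>(A :: ('q, 'a) right_qmodule) f (B :: ('q, 'b) right_qmodule) g
        (C :: ('q, 'c) right_qmodule).
      right_amalgam Q A f B g C \<and> carrier A \<noteq> {} \<longrightarrow>
      (\<exists>(D :: ('q, 'd) right_qmodule) f' g'. right_strong_completion Q A f B g C D f' g'))"

end

theory Submission
  imports Defs
begin

text \<open>
  Every sup-preserving map \<open>h\<close> has an upper adjoint \<open>h\<^sub>*\<close>. The amalgam is the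
  pushout, realised as the pullback of \<open>f\<^sub>*\<close> and \<open>g\<^sub>*\<close>: it consists of the pairs
  \<open>(b, c)\<close> such that \<open>f a \<le> b\<close> iff \<open>g a \<le> c\<close> for all \<open>a\<close>. This subset of \<open>B \<times> C\<close> is closed
  under meets and under the residuals \<open>y \<mapsto> q \ y\<close>, hence it is a quotient module of the
  coproduct \<open>B \<times> C\<close>. The embeddings are the lower adjoints of the two projections, namely
  \<open>b \<mapsto> (b, g (f\<^sub>* b))\<close> and \<open>c \<mapsto> (f (g\<^sub>* c), c)\<close>. If \<open>(b, g (f\<^sub>* b)) = (f (g\<^sub>* c), c)\<close>, then \<open>b\<close>
  lies in the image of \<open>f\<close>, which makes the amalgam strong. Right modules over \<open>Q\<close> are
  left modules over the opposite quantale.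
\<close>

section \<open>Upper adjoints\<close>

text \<open>The cases where \<open>z\<close> is \<open>x\<close> or \<open>y\<close> give the two
  inequalities. Equations between joins or actions are put in this form because adjunctions rewrite
  inequalities with the map on the left.\<close>

lemma (in partial_order) eq_if_same_upper_bounds:
  assumes "x \<in> carrier L" "y \<in> carrier L"
    and "\<And>z. z \<in> carrier L \<Longrightarrow> x \<sqsubseteq> z \<longleftrightarrow> y \<sqsubseteq> z"
  shows "x = y"
  using assms by (meson le_antisym le_refl)

lemma (in complete_lattice) sup_le_iff:
  assumes "X \<subseteq> carrier L" "y \<in> carrier L"
  shows "\<Squnion>X \<sqsubseteq> y \<longleftrightarrow> (\<forall>x\<in>X. x \<sqsubseteq> y)"
  using assms by (meson le_trans subsetD sup_closed sup_least sup_upper)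

lemma (in complete_lattice) le_inf_iff:
  assumes "X \<subseteq> carrier L" "y \<in> carrier L"
  shows "y \<sqsubseteq> \<Sqinter>X \<longleftrightarrow> (\<forall>x\<in>X. y \<sqsubseteq> x)"
  using assms by (meson le_trans subsetD inf_closed inf_greatest inf_lower)

definition upper_adj ::
  "('a, 'u) gorder_scheme \<Rightarrow> ('b, 'v) gorder_scheme \<Rightarrow> ('a \<Rightarrow> 'b) \<Rightarrow> 'b \<Rightarrow> 'a" where
  "upper_adj X Y h y = \<Squnion>\<^bsub>X\<^esub> {x \<in> carrier X. h x \<sqsubseteq>\<^bsub>Y\<^esub> y}"

lemma upper_adj_closed:
  assumes "complete_lattice X"
  shows "upper_adj X Y h y \<in> carrier X"
proof -
  interpret X: complete_lattice X by fact
  show ?thesis unfolding upper_adj_def by (rule X.sup_closed) auto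
qed

text \<open>The inequality says that \<open>x'\<close> is the join of the pair
  \<open>{x, x'}\<close>, and \<open>h\<close> preserves this join.\<close>

lemma sup_pres_mono:
  assumes h: "sup_pres X Y h" "h \<in> carrier X \<rightarrow> carrier Y"
    and x: "x \<in> carrier X" "x' \<in> carrier X" "x \<sqsubseteq>\<^bsub>X\<^esub> x'"
  shows "h x \<sqsubseteq>\<^bsub>Y\<^esub> h x'"
proof -
  interpret X: complete_lattice X using h by (simp add: sup_pres_def)
  interpret Y: complete_lattice Y using h by (simp add: sup_pres_def)
  have "\<Squnion>\<^bsub>X\<^esub> {x, x'} = x'"
    by (rule X.eq_if_same_upper_bounds)
      (use x in \<open>auto simp: X.sup_le_iff intro: X.le_trans\<close>)
  moreover have "{x, x'} \<subseteq> carrier X"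
    using x by simp
  then have "h (\<Squnion>\<^bsub>X\<^esub> {x, x'}) = \<Squnion>\<^bsub>Y\<^esub> (h ` {x, x'})"
    using h(1) unfolding sup_pres_def by (elim conjE allE[of _ "{x, x'}"] impE)
  ultimately have "h x' = \<Squnion>\<^bsub>Y\<^esub> (h ` {x, x'})"
    by simp
  moreover have "h x \<sqsubseteq>\<^bsub>Y\<^esub> \<Squnion>\<^bsub>Y\<^esub> (h ` {x, x'})"
    by (rule Y.sup_upper) (use h x in auto)
  ultimately show ?thesis by simp
qed

text \<open>Preservation of the defining join gives the counit
  \<open>h (upper_adj X Y h y) \<le> y\<close>. One direction is membership in the set being joined,
  the other is monotonicity followed by the counit.\<close>

lemma upper_adj_iff:
  assumes h: "sup_pres X Y h" "h \<in> carrier X \<rightarrow> carrier Y"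
    and xy: "x \<in> carrier X" "y \<in> carrier Y"
  shows "h x \<sqsubseteq>\<^bsub>Y\<^esub> y \<longleftrightarrow> x \<sqsubseteq>\<^bsub>X\<^esub> upper_adj X Y h y"
proof -
  interpret X: complete_lattice X using h by (simp add: sup_pres_def)
  interpret Y: complete_lattice Y using h by (simp add: sup_pres_def)
  let ?S = "{x \<in> carrier X. h x \<sqsubseteq>\<^bsub>Y\<^esub> y}"
  have S: "?S \<subseteq> carrier X" by auto
  have cl: "upper_adj X Y h y \<in> carrier X"
    by (rule upper_adj_closed) unfold_locales
  have "h (upper_adj X Y h y) = \<Squnion>\<^bsub>Y\<^esub> (h ` ?S)"
    using h S unfolding sup_pres_def upper_adj_def by blast
  moreover have "\<Squnion>\<^bsub>Y\<^esub> (h ` ?S) \<sqsubseteq>\<^bsub>Y\<^esub> y"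
    by (rule Y.sup_least) (use h xy in auto)
  ultimately have counit: "h (upper_adj X Y h y) \<sqsubseteq>\<^bsub>Y\<^esub> y"
    by simp
  show ?thesis
  proof
    assume "h x \<sqsubseteq>\<^bsub>Y\<^esub> y"
    then show "x \<sqsubseteq>\<^bsub>X\<^esub> upper_adj X Y h y"
      unfolding upper_adj_def using xy by (intro X.sup_upper) auto
  next
    assume "x \<sqsubseteq>\<^bsub>X\<^esub> upper_adj X Y h y"
    then have "h x \<sqsubseteq>\<^bsub>Y\<^esub> h (upper_adj X Y h y)"
      using sup_pres_mono[OF h] xy cl by blast
    then show "h x \<sqsubseteq>\<^bsub>Y\<^esub> y"
      using counit xy cl h by (meson Pi_mem Y.le_trans)
  qed
qed

text \<open>An element \<open>z\<close> bounds \<open>h\<close> of the join of \<open>S\<close> iff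
  \<open>r z\<close> bounds \<open>S\<close> iff \<open>z\<close> bounds the image of
  \<open>S\<close>. Join preservation in the pushout is always shown by exhibiting such an
  \<open>r\<close>.\<close>

lemma sup_pres_if_adjoint:
  assumes "complete_lattice X" "complete_lattice Y" and h: "h \<in> carrier X \<rightarrow> carrier Y"
    and r: "\<And>y. y \<in> carrier Y \<Longrightarrow> r y \<in> carrier X"
    and adj: "\<And>x y. \<lbrakk>x \<in> carrier X; y \<in> carrier Y\<rbrakk> \<Longrightarrow> h x \<sqsubseteq>\<^bsub>Y\<^esub> y \<longleftrightarrow> x \<sqsubseteq>\<^bsub>X\<^esub> r y"
  shows "sup_pres X Y h"
proof -
  interpret X: complete_lattice X by fact
  interpret Y: complete_lattice Y by fact
  have "h (\<Squnion>\<^bsub>X\<^esub> S) = \<Squnion>\<^bsub>Y\<^esub> (h ` S)" if S: "S \<subseteq> carrier X" for S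
  proof (rule Y.eq_if_same_upper_bounds)
    have hS: "h ` S \<subseteq> carrier Y" using S h by auto
    show "h (\<Squnion>\<^bsub>X\<^esub> S) \<in> carrier Y" using S h by auto
    show "\<Squnion>\<^bsub>Y\<^esub> (h ` S) \<in> carrier Y" using hS by auto
    fix z assume z: "z \<in> carrier Y"
    have "h (\<Squnion>\<^bsub>X\<^esub> S) \<sqsubseteq>\<^bsub>Y\<^esub> z \<longleftrightarrow> (\<forall>x\<in>S. x \<sqsubseteq>\<^bsub>X\<^esub> r z)"
      using S z r by (simp add: adj X.sup_le_iff)
    also have "\<dots> \<longleftrightarrow> (\<forall>x\<in>S. h x \<sqsubseteq>\<^bsub>Y\<^esub> z)"
      using S z adj by blast
    also have "\<dots> \<longleftrightarrow> \<Squnion>\<^bsub>Y\<^esub> (h ` S) \<sqsubseteq>\<^bsub>Y\<^esub> z"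
      using hS z by (simp add: Y.sup_le_iff)
    finally show "h (\<Squnion>\<^bsub>X\<^esub> S) \<sqsubseteq>\<^bsub>Y\<^esub> z \<longleftrightarrow> \<Squnion>\<^bsub>Y\<^esub> (h ` S) \<sqsubseteq>\<^bsub>Y\<^esub> z" .
  qed
  then show ?thesis
    using assms(1,2) by (simp add: sup_pres_def)
qed

section \<open>Residuals in a left module\<close>

text \<open>In a module, \<open>lresid M q y\<close> is the largest vector \<open>m\<close>, and
  \<open>rresid Q M m y\<close> the largest scalar \<open>q\<close>, with
  \<open>q \<star> m \<le> y\<close>.\<close>

definition lresid ::
  "('q, 'm, 'z) left_qmodule_scheme \<Rightarrow> 'q \<Rightarrow> 'm \<Rightarrow> 'm" where
  "lresid M q = upper_adj M M (\<lambda>m. q \<star>\<^bsub>M\<^esub> m)"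

definition rresid ::
  "('q, 'y) quantale_scheme \<Rightarrow> ('q, 'm, 'z) left_qmodule_scheme \<Rightarrow> 'm \<Rightarrow> 'm \<Rightarrow> 'q" where
  "rresid Q M m = upper_adj Q M (\<lambda>q. q \<star>\<^bsub>M\<^esub> m)"

context left_qmodule
begin

lemma complete_lattice_M: "complete_lattice M"
  using M.sup_lattice_axioms sup_lattice_iff_complete_lattice by blast

lemma lresid_closed: "lresid M q y \<in> carrier M"
  unfolding lresid_def by (rule upper_adj_closed[OF complete_lattice_M])

lemma rresid_closed: "rresid Q M m y \<in> carrier Q"
  unfolding rresid_def by (rule upper_adj_closed) unfold_locales

lemma lact_le_iff_lresid:
  "\<lbrakk>q \<in> carrier Q; x \<in> carrier M; y \<in> carrier M\<rbrakk> \<Longrightarrow>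
    q \<star>\<^bsub>M\<^esub> x \<sqsubseteq>\<^bsub>M\<^esub> y \<longleftrightarrow> x \<sqsubseteq>\<^bsub>M\<^esub> lresid M q y"
  unfolding lresid_def by (rule upper_adj_iff) (auto intro: lact_sup_vector lact_closed)

lemma lact_le_iff_rresid:
  "\<lbrakk>q \<in> carrier Q; x \<in> carrier M; y \<in> carrier M\<rbrakk> \<Longrightarrow>
    q \<star>\<^bsub>M\<^esub> x \<sqsubseteq>\<^bsub>M\<^esub> y \<longleftrightarrow> q \<sqsubseteq>\<^bsub>Q\<^esub> rresid Q M x y"
  unfolding rresid_def by (rule upper_adj_iff) (auto intro: lact_sup_scalar lact_closed)

end

text \<open>Equivariance of a lower adjoint is commutation of the upper adjoint with residuals.\<close>

lemma left_qmodule_hom_if_adjoint: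
  assumes "left_qmodule Q M" "left_qmodule Q N"
    and h: "h \<in> carrier M \<rightarrow> carrier N" and p: "p \<in> carrier N \<rightarrow> carrier M"
    and adj: "\<And>x y. \<lbrakk>x \<in> carrier M; y \<in> carrier N\<rbrakk> \<Longrightarrow> h x \<sqsubseteq>\<^bsub>N\<^esub> y \<longleftrightarrow> x \<sqsubseteq>\<^bsub>M\<^esub> p y"
    and res: "\<And>q y. \<lbrakk>q \<in> carrier Q; y \<in> carrier N\<rbrakk> \<Longrightarrow> p (lresid N q y) = lresid M q (p y)"
  shows "h \<in> left_qmodule_hom Q M N"
proof -
  interpret M: left_qmodule Q M by fact
  interpret N: left_qmodule Q N by fact
  have "sup_pres M N h"
    by (rule sup_pres_if_adjoint[OF M.complete_lattice_M N.complete_lattice_M h])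
      (use p adj in auto)
  moreover have "h (q \<star>\<^bsub>M\<^esub> m) = q \<star>\<^bsub>N\<^esub> h m" if qm: "q \<in> carrier Q" "m \<in> carrier M" for q m
  proof (rule N.M.eq_if_same_upper_bounds)
    have hm: "h m \<in> carrier N" using h qm by auto
    show "h (q \<star>\<^bsub>M\<^esub> m) \<in> carrier N" using h qm M.lact_closed by auto
    show "q \<star>\<^bsub>N\<^esub> h m \<in> carrier N" using hm qm N.lact_closed by auto
    fix y assume y: "y \<in> carrier N"
    \<comment> \<open>Adjointness moves \<open>h\<close> across the inequality and residuation moves
      \<open>q\<close>; \<open>res\<close> allows the two moves to be exchanged.\<close>
    have "h (q \<star>\<^bsub>M\<^esub> m) \<sqsubseteq>\<^bsub>N\<^esub> y \<longleftrightarrow> m \<sqsubseteq>\<^bsub>M\<^esub> lresid M q (p y)"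
      using adj M.lact_closed M.lact_le_iff_lresid qm y p by (metis Pi_mem)
    also have "\<dots> \<longleftrightarrow> h m \<sqsubseteq>\<^bsub>N\<^esub> lresid N q y"
      using adj res qm y N.lresid_closed by metis
    also have "\<dots> \<longleftrightarrow> q \<star>\<^bsub>N\<^esub> h m \<sqsubseteq>\<^bsub>N\<^esub> y"
      using N.lact_le_iff_lresid qm hm y by metis
    finally show "h (q \<star>\<^bsub>M\<^esub> m) \<sqsubseteq>\<^bsub>N\<^esub> y \<longleftrightarrow> q \<star>\<^bsub>N\<^esub> h m \<sqsubseteq>\<^bsub>N\<^esub> y" .
  qed
  ultimately show ?thesis
    using h by (simp add: left_qmodule_hom_def)
qed

section \<open>The pushout of an amalgam of left modules\<close>

locale left_qmodule_amalgam =
  fixes Q :: "('q, 'y) quantale_scheme" and A :: "('q, 'a) left_qmodule" and f :: "'a \<Rightarrow> 'b"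
    and B :: "('q, 'b) left_qmodule" and g :: "'a \<Rightarrow> 'c" and C :: "('q, 'c) left_qmodule"
  assumes amalgam: "left_amalgam Q A f B g C"
begin

lemma modules: "left_qmodule Q A" "left_qmodule Q B" "left_qmodule Q C"
  and homs: "f \<in> left_qmodule_hom Q A B" "g \<in> left_qmodule_hom Q A C"
  and injs: "inj_on f (carrier A)" "inj_on g (carrier A)"
  using amalgam by (auto simp: left_amalgam_def)

sublocale A: left_qmodule Q A by (rule modules)
sublocale B: left_qmodule Q B by (rule modules)
sublocale C: left_qmodule Q C by (rule modules)
sublocale AL: complete_lattice A by (rule A.complete_lattice_M)
sublocale BL: complete_lattice B by (rule B.complete_lattice_M)
sublocale CL: complete_lattice C by (rule C.complete_lattice_M)

text \<open>The symmetry of the hypothesis turns each fact about \<open>f\<close> into the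
  corresponding fact about \<open>g\<close>.\<close>

lemma swap: "left_qmodule_amalgam Q A g C f B"
  using amalgam by unfold_locales (auto simp: left_amalgam_def)

section \<open>The injections and their upper adjoints\<close>

abbreviation f_adj where "f_adj \<equiv> upper_adj A B f"
abbreviation g_adj where "g_adj \<equiv> upper_adj A C g"

lemma f_closed: "a \<in> carrier A \<Longrightarrow> f a \<in> carrier B"
  and f_sup_pres: "sup_pres A B f"
  and f_lact: "\<lbrakk>q \<in> carrier Q; a \<in> carrier A\<rbrakk> \<Longrightarrow> f (q \<star>\<^bsub>A\<^esub> a) = q \<star>\<^bsub>B\<^esub> f a"
  using homs by (auto simp: left_qmodule_hom_def)

lemma f_adj_closed: "f_adj b \<in> carrier A"
  by (rule upper_adj_closed) unfold_locales

lemma f_le_iff: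
  "\<lbrakk>a \<in> carrier A; b \<in> carrier B\<rbrakk> \<Longrightarrow> f a \<sqsubseteq>\<^bsub>B\<^esub> b \<longleftrightarrow> a \<sqsubseteq>\<^bsub>A\<^esub> f_adj b"
  by (rule upper_adj_iff) (auto intro: f_sup_pres f_closed)

text \<open>Every adjunction satisfies \<open>f (f_adj (f a)) = f a\<close>; injectivity cancels the
  outer \<open>f\<close>.\<close>

lemma f_adj_f:
  assumes a: "a \<in> carrier A"
  shows "f_adj (f a) = a"
proof -
  have "f (f_adj (f a)) \<sqsubseteq>\<^bsub>B\<^esub> f a"
    by (simp add: f_le_iff f_adj_closed f_closed a)
  moreover have "a \<sqsubseteq>\<^bsub>A\<^esub> f_adj (f a)"
    using f_le_iff[of a "f a"] f_closed a by simp
  then have "f a \<sqsubseteq>\<^bsub>B\<^esub> f (f_adj (f a))"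
    by (intro sup_pres_mono[OF f_sup_pres]) (auto simp: f_closed f_adj_closed a)
  ultimately have "f (f_adj (f a)) = f a"
    by (meson B.M.le_antisym a f_adj_closed f_closed)
  then show ?thesis
    using injs a f_adj_closed by (meson inj_onD)
qed

text \<open>An injective sup-preserving map reflects the order, because its upper adjoint is a left
  inverse.\<close>

lemma f_emb: "\<lbrakk>a \<in> carrier A; a' \<in> carrier A\<rbrakk> \<Longrightarrow> f a \<sqsubseteq>\<^bsub>B\<^esub> f a' \<longleftrightarrow> a \<sqsubseteq>\<^bsub>A\<^esub> a'"
  by (simp add: f_le_iff f_closed f_adj_f)

lemma f_le_lresid_iff:
  "\<lbrakk>q \<in> carrier Q; a \<in> carrier A; b \<in> carrier B\<rbrakk> \<Longrightarrow>
    f a \<sqsubseteq>\<^bsub>B\<^esub> lresid B q b \<longleftrightarrow> f (q \<star>\<^bsub>A\<^esub> a) \<sqsubseteq>\<^bsub>B\<^esub> b"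
  by (simp add: f_lact B.lact_le_iff_lresid f_closed)

lemmas g_closed = left_qmodule_amalgam.f_closed[OF swap]
  and g_adj_closed = left_qmodule_amalgam.f_adj_closed[OF swap]
  and g_le_iff = left_qmodule_amalgam.f_le_iff[OF swap]
  and g_adj_g = left_qmodule_amalgam.f_adj_f[OF swap]
  and g_emb = left_qmodule_amalgam.f_emb[OF swap]
  and g_le_lresid_iff = left_qmodule_amalgam.f_le_lresid_iff[OF swap]

section \<open>The pullback of the upper adjoints as a complete lattice\<close>

definition pb :: "('b \<times> 'c) set" where
  "pb = {x \<in> carrier B \<times> carrier C.
    \<forall>a\<in>carrier A. f a \<sqsubseteq>\<^bsub>B\<^esub> fst x \<longleftrightarrow> g a \<sqsubseteq>\<^bsub>C\<^esub> snd x}"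

definition ple :: "'b \<times> 'c \<Rightarrow> 'b \<times> 'c \<Rightarrow> bool" where
  "ple x y \<longleftrightarrow> fst x \<sqsubseteq>\<^bsub>B\<^esub> fst y \<and> snd x \<sqsubseteq>\<^bsub>C\<^esub> snd y"

definition pinf :: "('b \<times> 'c) set \<Rightarrow> 'b \<times> 'c" where
  "pinf S = (\<Sqinter>\<^bsub>B\<^esub> (fst ` S), \<Sqinter>\<^bsub>C\<^esub> (snd ` S))"

text \<open>The reflection of \<open>B \<times> C\<close> onto \<open>pb\<close>, that is, the
  closure operator whose closed elements are those of \<open>pb\<close>.\<close>

definition pclos :: "'b \<times> 'c \<Rightarrow> 'b \<times> 'c" where
  "pclos x = pinf {y \<in> pb. ple x y}"

definition pact :: "'q \<Rightarrow> 'b \<times> 'c \<Rightarrow> 'b \<times> 'c" where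
  "pact q x = (q \<star>\<^bsub>B\<^esub> fst x, q \<star>\<^bsub>C\<^esub> snd x)"

definition pres :: "'q \<Rightarrow> 'b \<times> 'c \<Rightarrow> 'b \<times> 'c" where
  "pres q x = (lresid B q (fst x), lresid C q (snd x))"

text \<open>The coordinatewise action may leave \<open>pb\<close>, so it is followed by the closure,
  as in a quotient represented by closed elements.\<close>

definition pushout :: "('q, 'b \<times> 'c) left_qmodule" where
  "pushout = \<lparr>carrier = pb, eq = (=), le = ple, lact = (\<lambda>q x. pclos (pact q x))\<rparr>"

lemma pushout_simps [simp]:
  "carrier pushout = pb" "eq pushout = (=)" "le pushout = ple"
  "q \<star>\<^bsub>pushout\<^esub> x = pclos (pact q x)"
  by (simp_all add: pushout_def)

lemma pb_closed: "x \<in> pb \<Longrightarrow> fst x \<in> carrier B" "x \<in> pb \<Longrightarrow> snd x \<in> carrier C"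
  by (auto simp: pb_def)

lemma pb_sub: "x \<in> pb \<Longrightarrow> x \<in> carrier B \<times> carrier C"
  by (simp add: pb_def)

lemma pb_images:
  assumes "S \<subseteq> pb"
  shows "fst ` S \<subseteq> carrier B" "snd ` S \<subseteq> carrier C"
  using pb_closed subsetD[OF assms] by blast+

lemma ple_refl: "x \<in> carrier B \<times> carrier C \<Longrightarrow> ple x x"
  by (auto simp: ple_def)

lemma ple_trans:
  "\<lbrakk>ple x y; ple y z; x \<in> carrier B \<times> carrier C; y \<in> carrier B \<times> carrier C;
    z \<in> carrier B \<times> carrier C\<rbrakk> \<Longrightarrow> ple x z"
  unfolding ple_def mem_Times_iff by (meson B.M.le_trans C.M.le_trans)

lemma ple_antisym:
  "\<lbrakk>ple x y; ple y x; x \<in> carrier B \<times> carrier C; y \<in> carrier B \<times> carrier C\<rbrakk> \<Longrightarrow> x = y"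
  unfolding ple_def mem_Times_iff prod_eq_iff by (meson B.M.le_antisym C.M.le_antisym)

text \<open>The condition defining \<open>pb\<close> says that the two upper adjoints agree, but
  mentions only inequalities with \<open>f a\<close> or \<open>g a\<close> on the left. Such
  inequalities hold for a meet iff they hold for all its members.\<close>

lemma pinf_closed:
  assumes "S \<subseteq> pb"
  shows "pinf S \<in> pb"
proof -
  note S = pb_images[OF assms]
  have "f a \<sqsubseteq>\<^bsub>B\<^esub> \<Sqinter>\<^bsub>B\<^esub> (fst ` S) \<longleftrightarrow> g a \<sqsubseteq>\<^bsub>C\<^esub> \<Sqinter>\<^bsub>C\<^esub> (snd ` S)"
    if a: "a \<in> carrier A" for a
  proof -
    have "f a \<sqsubseteq>\<^bsub>B\<^esub> fst x \<longleftrightarrow> g a \<sqsubseteq>\<^bsub>C\<^esub> snd x" if "x \<in> S" for x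
      using subsetD[OF assms that] a by (simp add: pb_def)
    then show ?thesis
      using a by (simp add: BL.le_inf_iff CL.le_inf_iff S f_closed g_closed)
  qed
  then show ?thesis
    using S by (simp add: pb_def pinf_def)
qed

lemma le_pinf_iff:
  assumes "S \<subseteq> pb" "x \<in> carrier B \<times> carrier C"
  shows "ple x (pinf S) \<longleftrightarrow> (\<forall>y\<in>S. ple x y)"
proof -
  note S = pb_images[OF assms(1)]
  show ?thesis
    using assms(2)
    by (simp add: mem_Times_iff ple_def pinf_def BL.le_inf_iff CL.le_inf_iff S ball_conj_distrib)
qed

lemma pclos_closed: "pclos x \<in> pb"
  unfolding pclos_def by (rule pinf_closed) auto

text \<open>\<open>pclos x\<close> lies above \<open>x\<close> as a meet of elements above
  \<open>x\<close>; any \<open>y\<close> in \<open>pb\<close> above \<open>x\<close> is one of these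
  elements.\<close>

lemma pclos_le_iff:
  assumes x: "x \<in> carrier B \<times> carrier C" and y: "y \<in> pb"
  shows "ple (pclos x) y \<longleftrightarrow> ple x y"
proof -
  let ?S = "{y \<in> pb. ple x y}"
  have S: "?S \<subseteq> pb" by auto
  have *: "pclos x \<in> carrier B \<times> carrier C" using pclos_closed pb_sub by blast
  have "ple x (pclos x)"
    using x S by (simp add: pclos_def le_pinf_iff)
  moreover have "ple (pclos x) y" if "ple x y"
    using le_pinf_iff[OF S *] ple_refl[OF *] that y unfolding pclos_def by blast
  ultimately show ?thesis
    using ple_trans[OF _ _ x * pb_sub[OF y]] by blast
qed

lemma pact_closed: "\<lbrakk>q \<in> carrier Q; x \<in> pb\<rbrakk> \<Longrightarrow> pact q x \<in> carrier B \<times> carrier C"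
  by (simp add: pact_def pb_closed B.lact_closed C.lact_closed)

text \<open>By equivariance of \<open>f\<close> and \<open>g\<close>, the condition on
  \<open>pres q x\<close> at \<open>a\<close> is the condition on \<open>x\<close> at
  \<open>q \<star> a\<close>.\<close>

lemma pres_closed: "\<lbrakk>q \<in> carrier Q; x \<in> pb\<rbrakk> \<Longrightarrow> pres q x \<in> pb"
  by (auto simp: pres_def pb_def B.lresid_closed C.lresid_closed
      f_le_lresid_iff g_le_lresid_iff A.lact_closed)

lemma act_le_iff:
  assumes "q \<in> carrier Q" "x \<in> pb" "y \<in> pb"
  shows "ple (pclos (pact q x)) y \<longleftrightarrow> ple x (pres q y)"
  using assms
  by (simp add: pclos_le_iff pact_closed)
    (simp add: ple_def pact_def pres_def pb_closed B.lact_le_iff_lresid C.lact_le_iff_lresid)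

sublocale D: complete_lattice pushout
proof -
  interpret D: partial_order pushout
    by unfold_locales (simp_all, (blast intro: ple_refl ple_trans ple_antisym pb_sub)+)
  have join: "\<exists>s. least pushout s (Upper pushout S)" if "S \<subseteq> carrier pushout" for S
  proof (intro exI least_UpperI)
    \<comment> \<open>The coordinatewise join may leave \<open>pb\<close>, so the join is obtained
      as the meet of all upper bounds.\<close>
    let ?U = "Upper pushout S"
    have U: "?U \<subseteq> pb" using Upper_closed[of pushout S] by simp
    show "S \<subseteq> carrier pushout" by fact
    show "pinf ?U \<in> carrier pushout" using pinf_closed[OF U] by simp
    show "x \<sqsubseteq>\<^bsub>pushout\<^esub> pinf ?U" if x: "x \<in> S" for x
    proof -
      have "x \<in> pb"
        using x \<open>S \<subseteq> carrier pushout\<close> by auto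
      moreover have "ple x u" if "u \<in> ?U" for u
        using Upper_memD[OF that x \<open>S \<subseteq> carrier pushout\<close>] by simp
      ultimately show ?thesis
        by (simp add: le_pinf_iff[OF U pb_sub])
    qed
    show "pinf ?U \<sqsubseteq>\<^bsub>pushout\<^esub> y" if "y \<in> ?U" for y
      using that le_pinf_iff[OF U pb_sub[OF pinf_closed[OF U]]]
        ple_refl[OF pb_sub[OF pinf_closed[OF U]]] by simp
  qed
  have "sup_lattice pushout"
    by unfold_locales (rule join)
  then show "complete_lattice pushout"
    by (simp add: sup_lattice_iff_complete_lattice)
qed

section \<open>The module structure on the pullback\<close>

lemma left_qmodule_pushout: "left_qmodule Q pushout"
proof -
  have sup_lattice: "sup_lattice pushout"
    using D.complete_lattice_axioms by (simp add: sup_lattice_iff_complete_lattice)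
  have cQ: "complete_lattice Q" by unfold_locales
  show ?thesis
  proof (intro left_qmodule.intro left_qmodule_axioms.intro sup_lattice
      A.Q.quantale_axioms)
    fix q m assume "q \<in> carrier Q" "m \<in> carrier pushout"
    then show "q \<star>\<^bsub>pushout\<^esub> m \<in> carrier pushout"
      by (simp add: pclos_closed)
  next
    fix m assume m: "m \<in> carrier pushout"
    \<comment> \<open>A scalar must satisfy the residual bound in both coordinates, so the right
      adjoint is the meet of the two residuals.\<close>
    let ?r = "\<lambda>y. rresid Q B (fst m) (fst y) \<sqinter>\<^bsub>Q\<^esub> rresid Q C (snd m) (snd y)"
    show "sup_pres Q pushout (\<lambda>q. q \<star>\<^bsub>pushout\<^esub> m)"
    proof (rule sup_pres_if_adjoint[where r = ?r, OF cQ D.complete_lattice_axioms])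
      show "?r y \<in> carrier Q" for y
        by (simp add: B.rresid_closed C.rresid_closed)
      fix q y assume qy: "q \<in> carrier Q" "y \<in> carrier pushout"
      have "q \<star>\<^bsub>pushout\<^esub> m \<sqsubseteq>\<^bsub>pushout\<^esub> y \<longleftrightarrow>
          q \<sqsubseteq>\<^bsub>Q\<^esub> rresid Q B (fst m) (fst y) \<and> q \<sqsubseteq>\<^bsub>Q\<^esub> rresid Q C (snd m) (snd y)"
        using m qy
        by (simp add: pclos_le_iff pact_closed)
          (simp add: ple_def pact_def pb_closed B.lact_le_iff_rresid C.lact_le_iff_rresid)
      also have "\<dots> \<longleftrightarrow> q \<sqsubseteq>\<^bsub>Q\<^esub> ?r y"
        using qy B.rresid_closed C.rresid_closed by (simp add: meet_def A.Q.le_inf_iff)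
      finally show "q \<star>\<^bsub>pushout\<^esub> m \<sqsubseteq>\<^bsub>pushout\<^esub> y \<longleftrightarrow> q \<sqsubseteq>\<^bsub>Q\<^esub> ?r y" .
    qed (use m in \<open>auto simp: pclos_closed\<close>)
  next
    fix q assume "q \<in> carrier Q"
    then show "sup_pres pushout pushout (\<lambda>m. q \<star>\<^bsub>pushout\<^esub> m)"
      by (intro sup_pres_if_adjoint[where r = "pres q"])
        (auto simp: D.complete_lattice_axioms pclos_closed pres_closed act_le_iff)
  next
    fix p q m assume pqm: "p \<in> carrier Q" "q \<in> carrier Q" "m \<in> carrier pushout"
    interpret Qm: monoid "\<lparr>carrier = carrier Q, monoid.mult = (\<cdot>\<^bsub>Q\<^esub>), one = qunit Q\<rparr>"
      by (rule A.Q.qmult_monoid)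
    have pq: "p \<cdot>\<^bsub>Q\<^esub> q \<in> carrier Q"
      using Qm.m_closed pqm by simp
    show "(p \<cdot>\<^bsub>Q\<^esub> q) \<star>\<^bsub>pushout\<^esub> m = p \<star>\<^bsub>pushout\<^esub> (q \<star>\<^bsub>pushout\<^esub> m)"
    proof (rule D.eq_if_same_upper_bounds)
      fix z assume "z \<in> carrier pushout"
      then have z: "z \<in> pb" by simp
      \<comment> \<open>Upper bounds in \<open>pb\<close> do not see the outer closure. Once
        \<open>p\<close> is moved to the right, the inner closure disappears as well, because
        \<open>pres p z\<close> lies in \<open>pb\<close>.\<close>
      have "ple (pclos (pact (p \<cdot>\<^bsub>Q\<^esub> q) m)) z \<longleftrightarrow> ple (pact (p \<cdot>\<^bsub>Q\<^esub> q) m) z"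
        using pqm pq z by (simp add: pclos_le_iff pact_closed)
      also have "\<dots> \<longleftrightarrow> ple (pact q m) (pres p z)"
        using pqm z
        by (simp add: ple_def pact_def pres_def pb_closed B.lact_assoc C.lact_assoc
            B.lact_closed C.lact_closed B.lact_le_iff_lresid C.lact_le_iff_lresid)
      also have "\<dots> \<longleftrightarrow> ple (pclos (pact q m)) (pres p z)"
        using pqm z by (simp add: pclos_le_iff pact_closed pres_closed)
      also have "\<dots> \<longleftrightarrow> ple (pclos (pact p (pclos (pact q m)))) z"
        using pqm z pclos_closed by (simp add: act_le_iff)
      finally show "(p \<cdot>\<^bsub>Q\<^esub> q) \<star>\<^bsub>pushout\<^esub> m \<sqsubseteq>\<^bsub>pushout\<^esub> z \<longleftrightarrow>
          p \<star>\<^bsub>pushout\<^esub> (q \<star>\<^bsub>pushout\<^esub> m) \<sqsubseteq>\<^bsub>pushout\<^esub> z"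
        by simp
    qed (auto simp: pclos_closed)
  next
    fix m assume m: "m \<in> carrier pushout"
    then have "pact (qunit Q) m = m"
      by (simp add: pact_def pb_closed B.lact_unit C.lact_unit)
    then show "qunit Q \<star>\<^bsub>pushout\<^esub> m = m"
      using m pb_sub
      by (intro D.eq_if_same_upper_bounds) (auto simp: pclos_closed pclos_le_iff)
  qed
qed

sublocale D: left_qmodule Q pushout
  by (rule left_qmodule_pushout)

text \<open>Both sides are right adjoint to the same action, and adjoints are unique. Residuals are
  thus coordinatewise, so the projections commute with them, which makes \<open>inB\<close> and
  \<open>inC\<close> equivariant.\<close>

lemma lresid_pushout:
  assumes "q \<in> carrier Q" "y \<in> pb"
  shows "lresid pushout q y = pres q y"
proof -
  have "ple x (lresid pushout q y) \<longleftrightarrow> ple x (pres q y)" if "x \<in> pb" for x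
    using D.lact_le_iff_lresid[of q x y] act_le_iff[of q x y] that assms by simp
  moreover have "lresid pushout q y \<in> pb" "pres q y \<in> pb"
    using D.lresid_closed[of q y] pres_closed assms by auto
  ultimately show ?thesis
    by (meson pb_sub ple_antisym ple_refl)
qed

section \<open>The two embeddings and strong amalgamation\<close>

definition inB :: "'b \<Rightarrow> 'b \<times> 'c" where "inB b = (b, g (f_adj b))"
definition inC :: "'c \<Rightarrow> 'b \<times> 'c" where "inC c = (f (g_adj c), c)"

text \<open>Both \<open>f a \<le> b\<close> and \<open>g a \<le> g (f_adj b)\<close> amount to
  \<open>a \<le> f_adj b\<close>, the second because \<open>g\<close> is an order embedding.\<close>

lemma inB_closed: "b \<in> carrier B \<Longrightarrow> inB b \<in> pb"
  by (simp add: inB_def pb_def f_adj_closed g_closed g_emb f_le_iff)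

lemma inC_closed: "c \<in> carrier C \<Longrightarrow> inC c \<in> pb"
  by (simp add: inC_def pb_def g_adj_closed f_closed f_emb g_le_iff)

text \<open>If \<open>b \<le> fst x\<close>, the counit puts \<open>f (f_adj b)\<close> below
  \<open>fst x\<close>; membership of \<open>x\<close> in \<open>pb\<close> then puts
  \<open>g (f_adj b)\<close> below \<open>snd x\<close>.\<close>

lemma inB_le_iff:
  assumes b: "b \<in> carrier B" and x: "x \<in> pb"
  shows "ple (inB b) x \<longleftrightarrow> b \<sqsubseteq>\<^bsub>B\<^esub> fst x"
proof
  assume le: "b \<sqsubseteq>\<^bsub>B\<^esub> fst x"
  have "f (f_adj b) \<sqsubseteq>\<^bsub>B\<^esub> b"
    using b by (simp add: f_le_iff f_adj_closed)
  then have "f (f_adj b) \<sqsubseteq>\<^bsub>B\<^esub> fst x"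
    using le b x by (meson B.M.le_trans f_adj_closed f_closed pb_closed)
  then show "ple (inB b) x"
    using le x f_adj_closed by (simp add: ple_def inB_def pb_def)
qed (simp add: ple_def inB_def)

lemma inC_le_iff:
  assumes c: "c \<in> carrier C" and x: "x \<in> pb"
  shows "ple (inC c) x \<longleftrightarrow> c \<sqsubseteq>\<^bsub>C\<^esub> snd x"
proof
  assume le: "c \<sqsubseteq>\<^bsub>C\<^esub> snd x"
  have "g (g_adj c) \<sqsubseteq>\<^bsub>C\<^esub> c"
    using c by (simp add: g_le_iff g_adj_closed)
  then have "g (g_adj c) \<sqsubseteq>\<^bsub>C\<^esub> snd x"
    using le c x by (meson C.M.le_trans g_adj_closed g_closed pb_closed)
  then show "ple (inC c) x"
    using le x g_adj_closed by (simp add: ple_def inC_def pb_def)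
qed (simp add: ple_def inC_def)

lemma inB_hom: "inB \<in> left_qmodule_hom Q B pushout"
  by (rule left_qmodule_hom_if_adjoint[where p = fst])
    (auto simp: modules left_qmodule_pushout inB_closed pb_closed inB_le_iff
      lresid_pushout pres_def)

lemma inC_hom: "inC \<in> left_qmodule_hom Q C pushout"
  by (rule left_qmodule_hom_if_adjoint[where p = snd])
    (auto simp: modules left_qmodule_pushout inC_closed pb_closed inC_le_iff
      lresid_pushout pres_def)

lemma inB_f: "a \<in> carrier A \<Longrightarrow> inB (f a) = (f a, g a)"
  by (simp add: inB_def f_adj_f)

lemma inC_g: "a \<in> carrier A \<Longrightarrow> inC (g a) = (f a, g a)"
  by (simp add: inC_def g_adj_g)

lemma left_strong_completion_pushout: "left_strong_completion Q A f B g C pushout inB inC"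
proof -
  have comm: "\<forall>a\<in>carrier A. (inB \<circ> f) a = (inC \<circ> g) a"
    by (simp add: inB_f inC_g)
  then have image: "(inB \<circ> f) ` carrier A = (inC \<circ> g) ` carrier A"
    by (intro image_cong refl) blast
  have "inB ` carrier B \<inter> inC ` carrier C \<subseteq> (inB \<circ> f) ` carrier A"
  proof
    fix x assume "x \<in> inB ` carrier B \<inter> inC ` carrier C"
    then obtain b c where "x = inB b" "x = inC c" by blast
    \<comment> \<open>Comparing first coordinates of \<open>inB b\<close> and \<open>inC c\<close>
      gives \<open>b = f (g_adj c)\<close>, hence the witness in \<open>A\<close>.\<close>
    then have "x = (inB \<circ> f) (g_adj c)"
      by (auto simp: inB_def inC_def)
    then show "x \<in> (inB \<circ> f) ` carrier A"
      using g_adj_closed by blast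
  qed
  moreover have "(inB \<circ> f) ` carrier A \<subseteq> inB ` carrier B"
    using f_closed by auto
  moreover have "(inB \<circ> f) ` carrier A \<subseteq> inC ` carrier C"
    unfolding image using g_closed by auto
  ultimately have "inB ` carrier B \<inter> inC ` carrier C = (inB \<circ> f) ` carrier A"
    by (rule equalityI[OF _ Int_greatest])
  \<comment> \<open>Each embedding keeps its argument as one coordinate.\<close>
  moreover have "inj_on inB (carrier B)" "inj_on inC (carrier C)"
    by (auto simp: inj_on_def inB_def inC_def)
  ultimately show ?thesis
    unfolding left_strong_completion_def
    using left_qmodule_pushout inB_hom inC_hom comm image by (intro conjI)
qed

end

section \<open>Right modules as left modules over the opposite quantale\<close>

definition op_quantale :: "'q quantale \<Rightarrow> 'q quantale" where
  "op_quantale Q = Q\<lparr>qmult := \<lambda>a b. b \<cdot>\<^bsub>Q\<^esub> a\<rparr>"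

definition left_of_right :: "('q, 'm) right_qmodule \<Rightarrow> ('q, 'm) left_qmodule" where
  "left_of_right M =
    \<lparr>carrier = carrier M, eq = eq M, le = le M, lact = (\<lambda>q m. m \<triangleleft>\<^bsub>M\<^esub> q)\<rparr>"

definition right_of_left :: "('q, 'm) left_qmodule \<Rightarrow> ('q, 'm) right_qmodule" where
  "right_of_left M =
    \<lparr>carrier = carrier M, eq = eq M, le = le M, ract = (\<lambda>m q. q \<star>\<^bsub>M\<^esub> m)\<rparr>"

text \<open>Presents any left module over the opposite quantale as the translation of a right
  module, so that the amalgamating object can be translated back.\<close>

lemma left_of_right_of_left: "left_of_right (right_of_left M) = M"
  by (simp add: left_of_right_def right_of_left_def)

lemma op_quantale_simps [simp]:
  "carrier (op_quantale Q) = carrier Q" "eq (op_quantale Q) = eq Q" "le (op_quantale Q) = le Q"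
  "qmult (op_quantale Q) = (\<lambda>a b. b \<cdot>\<^bsub>Q\<^esub> a)" "qunit (op_quantale Q) = qunit Q"
  by (simp_all add: op_quantale_def)

lemma left_of_right_simps [simp]:
  "carrier (left_of_right M) = carrier M" "eq (left_of_right M) = eq M"
  "le (left_of_right M) = le M" "q \<star>\<^bsub>left_of_right M\<^esub> m = m \<triangleleft>\<^bsub>M\<^esub> q"
  by (simp_all add: left_of_right_def)

text \<open>The translations preserve the order fields but change the record type or the other
  fields, so order-theoretic notions are transferred between records that agree on
  \<open>carrier\<close>, \<open>eq\<close> and \<open>le\<close>.\<close>

lemma partial_order_cong:
  assumes "carrier L = carrier L'" "eq L = eq L'" "le L = le L'"
  shows "partial_order L \<longleftrightarrow> partial_order L'"
  using assms
  by (simp add: partial_order_def partial_order_axioms_def weak_partial_order_def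
      weak_partial_order_axioms_def equivalence_def)

lemma least_Upper_cong:
  assumes "carrier L = carrier L'" "le L = le L'"
  shows "least L s (Upper L S) \<longleftrightarrow> least L' s (Upper L' S)"
  using assms by (simp add: least_def Upper_def)

lemma complete_lattice_cong:
  assumes "carrier L = carrier L'" "eq L = eq L'" "le L = le L'"
  shows "complete_lattice L \<longleftrightarrow> complete_lattice L'"
  unfolding sup_lattice_iff_complete_lattice[symmetric] sup_lattice_def sup_lattice_axioms_def
  using partial_order_cong[OF assms] least_Upper_cong[OF assms(1,3)] assms(1) by simp

text \<open>A join is chosen among the least upper bounds, so equal least-upper-bound predicates
  yield the same chosen join.\<close>

lemma sup_pres_cong:
  assumes "carrier X = carrier X'" "eq X = eq X'" "le X = le X'"
    and "carrier Y = carrier Y'" "eq Y = eq Y'" "le Y = le Y'"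
  shows "sup_pres X Y h \<longleftrightarrow> sup_pres X' Y' h"
  unfolding sup_pres_def sup_def
  using complete_lattice_cong[OF assms(1-3)] complete_lattice_cong[OF assms(4-6)]
    least_Upper_cong[OF assms(1,3)] least_Upper_cong[OF assms(4,6)] assms(1) by simp

text \<open>Reversing the product exchanges the two distributive laws and the two unit laws.\<close>

lemma quantale_op_quantale:
  assumes "quantale Q"
  shows "quantale (op_quantale Q)"
proof -
  interpret quantale Q by fact
  interpret Qm: monoid "\<lparr>carrier = carrier Q, monoid.mult = (\<cdot>\<^bsub>Q\<^esub>), one = qunit Q\<rparr>"
    by (rule qmult_monoid)
  have pres: "sup_pres (op_quantale Q) (op_quantale Q) h \<longleftrightarrow> sup_pres Q Q h" for h
    by (rule sup_pres_cong) simp_all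
  have "complete_lattice (op_quantale Q)"
    using complete_lattice_cong[of "op_quantale Q" Q] complete_lattice_axioms by simp
  moreover have "monoid \<lparr>carrier = carrier (op_quantale Q),
      monoid.mult = (\<cdot>\<^bsub>op_quantale Q\<^esub>), one = qunit (op_quantale Q)\<rparr>"
    using Qm.m_closed Qm.m_assoc Qm.one_closed Qm.l_one Qm.r_one
    by unfold_locales simp_all
  ultimately show ?thesis
    unfolding quantale_def quantale_axioms_def pres
    using qmult_sup_left qmult_sup_right by simp
qed

lemma op_op_quantale: "op_quantale (op_quantale Q) = Q"
  by (simp add: op_quantale_def)

lemma quantale_op_quantale_iff: "quantale (op_quantale Q) \<longleftrightarrow> quantale Q"
  using quantale_op_quantale op_op_quantale by metis

lemma left_qmodule_left_of_right:
  "left_qmodule (op_quantale Q) (left_of_right M) \<longleftrightarrow> right_qmodule Q M"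
proof -
  have pres: "sup_pres (op_quantale Q) (left_of_right M) h \<longleftrightarrow> sup_pres Q M h"
    "sup_pres (left_of_right M) (left_of_right M) k \<longleftrightarrow> sup_pres M M k" for h k
    by (rule sup_pres_cong; simp)+
  have lat: "sup_lattice (left_of_right M) \<longleftrightarrow> sup_lattice M"
    unfolding sup_lattice_iff_complete_lattice by (rule complete_lattice_cong) simp_all
  show ?thesis
    unfolding left_qmodule_def right_qmodule_def left_qmodule_axioms_def
      right_qmodule_axioms_def quantale_op_quantale_iff lat
    by (auto simp: pres)
qed

lemma left_qmodule_hom_left_of_right:
  "left_qmodule_hom (op_quantale Q) (left_of_right M) (left_of_right N) =
    right_qmodule_hom Q M N"
proof -
  have "sup_pres (left_of_right M) (left_of_right N) h \<longleftrightarrow> sup_pres M N h" for h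
    by (rule sup_pres_cong) simp_all
  then show ?thesis
    by (simp add: left_qmodule_hom_def right_qmodule_hom_def)
qed

lemma left_amalgam_left_of_right:
  "left_amalgam (op_quantale Q) (left_of_right A) f (left_of_right B) g (left_of_right C) \<longleftrightarrow>
    right_amalgam Q A f B g C"
  by (simp add: left_amalgam_def right_amalgam_def left_qmodule_left_of_right
      left_qmodule_hom_left_of_right)

lemma left_strong_completion_left_of_right:
  "left_strong_completion (op_quantale Q) (left_of_right A) f (left_of_right B) g
      (left_of_right C) (left_of_right D) f' g' \<longleftrightarrow>
    right_strong_completion Q A f B g C D f' g'"
  by (simp add: left_strong_completion_def right_strong_completion_def
      left_qmodule_left_of_right left_qmodule_hom_left_of_right)

section \<open>Existence of strong completions on both sides\<close>

lemma left_completion_exists: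
  fixes Q :: "'q quantale" and A :: "('q, 'a) left_qmodule"
    and B :: "('q, 'b) left_qmodule" and C :: "('q, 'c) left_qmodule"
  assumes "left_amalgam Q A f B g C"
  shows "\<exists>D f' g'. left_strong_completion Q A f B g C (D :: ('q, 'b \<times> 'c) left_qmodule) f' g'"
  using left_qmodule_amalgam.left_strong_completion_pushout[OF left_qmodule_amalgam.intro]
    assms by blast

text \<open>The left result is applied over \<open>op_quantale Q\<close>; the object obtained there
  becomes a right module through \<open>right_of_left\<close>.\<close>

lemma right_completion_exists:
  fixes Q :: "'q quantale" and A :: "('q, 'a) right_qmodule"
    and B :: "('q, 'b) right_qmodule" and C :: "('q, 'c) right_qmodule"
  assumes "right_amalgam Q A f B g C"
  shows "\<exists>D f' g'. right_strong_completion Q A f B g C (D :: ('q, 'b \<times> 'c) right_qmodule) f' g'"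
  using left_completion_exists[OF left_amalgam_left_of_right[THEN iffD2, OF assms]]
    left_strong_completion_left_of_right left_of_right_of_left by metis

theorem theorem4p6p2:
  fixes Q :: "'q quantale"
  assumes "quantale Q"
  shows "left_strong_amalgamation_property Q
      TYPE('a) TYPE('b) TYPE('c) TYPE('b \<times> 'c)
      \<and> right_strong_amalgamation_property Q
      TYPE('a) TYPE('b) TYPE('c) TYPE('b \<times> 'c)"
  unfolding left_strong_amalgamation_property_def right_strong_amalgamation_property_def
  using left_completion_exists right_completion_exists by blast

end
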